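(* Let $p\geq 2$ be an integer and let $g(m)=\max\{\mathrm{Mad}(G) : e(G)=m\}$. (i) If $m=\binom{p}{2}$, then $g(m)=p-1$, with the unique extremal graph $K_p$. (ii) If $\binom{p}{2}<m<\binom{p+1}{2}$, say $m=\binom{p}{2}+r$ with $0<r<p$, then $g(m)=\max\{p-1,\,2m/(p+1)\}$, and it is attained by precisely the following graphs $G$ with $m$ edges: (a) any $G$ with $K_p\subset G$, if $0<r<\frac{p-1}{2}$; (b) any $G$ with $|V(G)|=p+1$, if $\frac{p-1}{2}<r<p$; (c) both types (a) and (b), if $r=\frac{p-1}{2}$.
   Context: For a finite graph $G$, $e(G)$ is its number of edges and $\mathrm{Mad}(G)=\max\{2e(H)/|V(H)| : H\subseteq G,\ |V(H)|\geq 1\}$. Graphs are considered up to isolated vertices (i.e., without isolated vertices) when identifying extremal graphs. *)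

theory Defs
  imports Complex_Main
begin

text \<open>
  Graphs are finite and simple: a pair of a vertex set and a set of two-element
  subsets of it. Vertices may have any type.
\<close>

type_synonym 'a ugraph = "'a set \<times> 'a set set"

abbreviation verts :: "'a ugraph \<Rightarrow> 'a set" where
  "verts G \<equiv> fst G"

abbreviation edges :: "'a ugraph \<Rightarrow> 'a set set" where
  "edges G \<equiv> snd G"

definition fin_graph :: "'a ugraph \<Rightarrow> bool" where
  "fin_graph G \<longleftrightarrow> finite (verts G) \<and> (\<forall>e \<in> edges G. e \<subseteq> verts G \<and> card e = 2)"

definition num_edges :: "'a ugraph \<Rightarrow> nat" where
  "num_edges G = card (edges G)"

definition no_isolated :: "'a ugraph \<Rightarrow> bool" where
  "no_isolated G \<longleftrightarrow> (\<forall>v \<in> verts G. \<exists>e \<in> edges G. v \<in> e)"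

definition subgraph :: "'a ugraph \<Rightarrow> 'a ugraph \<Rightarrow> bool" where
  "subgraph H G \<longleftrightarrow> fin_graph H \<and> fin_graph G \<and> verts H \<subseteq> verts G \<and> edges H \<subseteq> edges G"

definition graph_iso :: "'a ugraph \<Rightarrow> 'b ugraph \<Rightarrow> bool" where
  "graph_iso G H \<longleftrightarrow> (\<exists>f. bij_betw f (verts G) (verts H) \<and> edges H = (\<lambda>e. f ` e) ` edges G)"

definition complete_graph :: "nat \<Rightarrow> nat ugraph" where
  "complete_graph p = ({..<p}, {e. e \<subseteq> {..<p} \<and> card e = 2})"

definition contains_complete :: "nat \<Rightarrow> 'a ugraph \<Rightarrow> bool" where
  "contains_complete p G \<longleftrightarrow> (\<exists>H. subgraph H G \<and> graph_iso H (complete_graph p))"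

definition mad :: "'a ugraph \<Rightarrow> real" where
  "mad G = Max {2 * real (num_edges H) / real (card (verts H)) | H.
                  subgraph H G \<and> card (verts H) \<ge> 1}"

text \<open>
  It suffices to let the maximum range over graphs on natural numbers, since every
  finite graph is isomorphic to one of those; lemma \<open>mad_le_max_mad\<close> below
  confirms this. As \<open>Max\<close> is only meaningful on finite nonempty sets, this is also
  established below for the sets used here.
\<close>

definition max_mad :: "nat \<Rightarrow> real" where
  "max_mad m = Max {mad G | G :: nat ugraph. fin_graph G \<and> num_edges G = m}"

lemma finite_edges: "fin_graph G \<Longrightarrow> finite (edges G)"
  unfolding fin_graph_def by (metis Pow_iff finite_Pow_iff finite_subset subsetI)

lemma finite_mad_set:
  assumes "fin_graph G"
  shows "finite {2 * real (num_edges H) / real (card (verts H)) | H.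
                  subgraph H G \<and> card (verts H) \<ge> 1}" (is "finite ?S")
proof -
  have "?S \<subseteq> (\<lambda>H. 2 * real (num_edges H) / real (card (verts H))) `
              (Pow (verts G) \<times> Pow (edges G))"
    by (force simp: subgraph_def)
  moreover have "finite (Pow (verts G) \<times> Pow (edges G))"
    using assms finite_edges[OF assms] by (simp add: fin_graph_def)
  ultimately show ?thesis
    by (meson finite_imageI finite_subset)
qed

lemma mad_set_nonempty:
  assumes "fin_graph G" "verts G \<noteq> {}"
  shows "{2 * real (num_edges H) / real (card (verts H)) | H.
                  subgraph H G \<and> card (verts H) \<ge> 1} \<noteq> {}"
proof -
  have "subgraph G G \<and> card (verts G) \<ge> 1"
    using assms by (simp add: subgraph_def fin_graph_def Suc_le_eq card_gt_0_iff)
  then show ?thesis by blast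
qed

lemma mad_ge:
  assumes "subgraph H G" "card (verts H) \<ge> 1"
  shows "2 * real (num_edges H) / real (card (verts H)) \<le> mad G"
proof -
  have "fin_graph G" using assms(1) by (simp add: subgraph_def)
  then show ?thesis
    unfolding mad_def using assms by (intro Max_ge[OF finite_mad_set]) blast+
qed

lemma mad_attained:
  assumes "fin_graph G" "verts G \<noteq> {}"
  obtains H where "subgraph H G" "card (verts H) \<ge> 1"
    "mad G = 2 * real (num_edges H) / real (card (verts H))"
  using Max_in[OF finite_mad_set[OF assms(1)] mad_set_nonempty[OF assms]]
  unfolding mad_def by blast

lemma finite_max_mad_set:
  assumes "m \<ge> 1"
  shows "finite {mad G | G :: nat ugraph. fin_graph G \<and> num_edges G = m}" (is "finite ?S")
proof -
  have "?S \<subseteq> (\<lambda>(e, k). 2 * real e / real k) ` ({..m} \<times> {..2 * m})"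
  proof
    fix x assume "x \<in> ?S"
    then obtain G :: "nat ugraph" where G: "fin_graph G" "num_edges G = m" "x = mad G"
      by blast
    from G(2) assms obtain e where e: "e \<in> edges G"
      by (metis all_not_in_conv card.empty not_one_le_zero num_edges_def)
    with G(1) have e2: "e \<subseteq> verts G" "card e = 2" by (auto simp: fin_graph_def)
    then have ne: "verts G \<noteq> {}" by auto
    have "finite e" using e2(2) by (metis card.infinite zero_neq_numeral)
    then have "subgraph (e, {e}) G"
      using G(1) e e2 by (auto simp: subgraph_def fin_graph_def)
    from mad_ge[OF this] have ge1: "mad G \<ge> 1"
      using e2 by (simp add: num_edges_def)
    obtain H where H: "subgraph H G" "card (verts H) \<ge> 1"
      "mad G = 2 * real (num_edges H) / real (card (verts H))"
      using mad_attained[OF G(1) ne] by blast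
    have le: "num_edges H \<le> m"
      using H(1) G(2) finite_edges[OF G(1)] unfolding num_edges_def subgraph_def
      by (metis card_mono)
    have "real (card (verts H)) \<le> 2 * real (num_edges H)"
      using ge1 H(2,3) by (simp add: field_simps)
    then have "card (verts H) \<le> 2 * m" using le by linarith
    then show "x \<in> (\<lambda>(e, k). 2 * real e / real k) ` ({..m} \<times> {..2 * m})"
      using G(3) H(3) le by (force intro!: image_eqI[of _ _ "(num_edges H, card (verts H))"])
  qed
  then show ?thesis by (rule finite_subset) simp
qed

lemma max_mad_set_nonempty:
  "{mad G | G :: nat ugraph. fin_graph G \<and> num_edges G = m} \<noteq> {}"
proof -
  let ?E = "(\<lambda>i. {0, i}) ` {1..m}"
  have "inj_on (\<lambda>i. {0::nat, i}) {1..m}"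
    by (auto simp: inj_on_def doubleton_eq_iff)
  then have "num_edges ({0..m}, ?E) = m"
    by (simp add: num_edges_def card_image)
  moreover have "fin_graph ({0..m}, ?E)"
    by (auto simp: fin_graph_def card_insert_if)
  ultimately show ?thesis by blast
qed

lemma graph_iso_subgraph:
  fixes f :: "'a \<Rightarrow> 'b"
  assumes "inj_on f (verts G)" "subgraph H G"
  defines "F \<equiv> \<lambda>K. (f ` verts K, (\<lambda>e. f ` e) ` edges K)"
  shows "subgraph (F H) (F G)" "num_edges (F H) = num_edges H"
    "card (verts (F H)) = card (verts H)"
proof -
  have *: "fin_graph (F K)" if "fin_graph K" "verts K \<subseteq> verts G" for K
    using that assms(1) unfolding fin_graph_def F_def
    by (auto intro!: image_mono)
       (metis card_image inj_on_subset subset_trans)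
  show "subgraph (F H) (F G)"
    using *[of H] *[of G] assms(2) unfolding subgraph_def by (auto simp: F_def)
  have "edges H \<subseteq> Pow (verts G)"
    using assms(2) by (auto simp: subgraph_def fin_graph_def)
  then have "inj_on (\<lambda>e. f ` e) (edges H)"
    using assms(1) by (meson inj_on_image_Pow inj_on_subset)
  then show "num_edges (F H) = num_edges H"
    by (simp add: num_edges_def F_def card_image)
  show "card (verts (F H)) = card (verts H)"
    using assms(1,2) by (simp add: F_def subgraph_def card_image inj_on_subset)
qed

lemma mad_le_max_mad:
  fixes G :: "'a ugraph"
  assumes "fin_graph G" "num_edges G = m" "m \<ge> 1"
  shows "mad G \<le> max_mad m"
proof -
  obtain f :: "'a \<Rightarrow> nat" where f: "inj_on f (verts G)"
    using assms(1) finite_imp_inj_to_nat_seg[of "verts G"] by (auto simp: fin_graph_def)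
  let ?F = "\<lambda>K. (f ` verts K, (\<lambda>e. f ` e) ` edges K)"
  have GG: "subgraph G G" using assms(1) by (simp add: subgraph_def)
  obtain e where "e \<in> edges G"
    using assms(2,3) by (metis all_not_in_conv card.empty not_one_le_zero num_edges_def)
  then have "verts G \<noteq> {}" using assms(1) by (auto simp: fin_graph_def)
  then obtain H where H: "subgraph H G" "card (verts H) \<ge> 1"
      "mad G = 2 * real (num_edges H) / real (card (verts H))"
    using mad_attained[OF assms(1)] by blast
  note FH = graph_iso_subgraph[OF f H(1)] and FG = graph_iso_subgraph[OF f GG]
  have "mad G \<le> mad (?F G)"
    using mad_ge[OF FH(1)] FH(2,3) H(2,3) by simp
  moreover have "fin_graph (?F G)" "num_edges (?F G) = m"
    using FG(1,2) assms(2) by (simp_all add: subgraph_def)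
  then have "mad (?F G) \<le> max_mad m"
    unfolding max_mad_def by (intro Max_ge[OF finite_max_mad_set[OF assms(3)]]) blast
  ultimately show ?thesis by linarith
qed

end

theory Submission
  imports Defs
begin

text \<open>
  A subgraph with \<open>k \<le> p\<close> vertices has average degree at most \<open>k - 1 \<le> p - 1\<close>, with equality
  \<open>p - 1\<close> only for \<open>K\<^sub>p\<close>. A subgraph with \<open>k \<ge> p + 1\<close> vertices has average degree at most
  \<open>2m/k \<le> 2m/(p + 1)\<close>, with equality only if \<open>k = p + 1\<close> and it has all \<open>m\<close> edges. Both bounds
  are attained by \<open>K\<^sub>p\<close> together with one more vertex joined to \<open>r\<close> vertices of \<open>K\<^sub>p\<close>. The two
  bounds compare as \<open>2r\<close> does with \<open>p - 1\<close>, and case (i) is \<open>r = 0\<close>.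
\<close>

lemma Suc_choose_two: "Suc n choose 2 = n + (n choose 2)"
  by (simp add: numeral_2_eq_2)

lemma of_nat_choose_two:
  "2 * of_nat (n choose 2) = of_nat n * (of_nat n - 1 :: 'a :: comm_ring_1)"
  by (induction n) (simp_all add: binomial_eq_0 Suc_choose_two algebra_simps)

definition all_edges :: "'a set \<Rightarrow> 'a set set" where
  "all_edges V = {e. e \<subseteq> V \<and> card e = 2}"

lemma finite_all_edges: "finite V \<Longrightarrow> finite (all_edges V)"
  by (simp add: all_edges_def)

lemma card_all_edges: "finite V \<Longrightarrow> card (all_edges V) = card V choose 2"
  by (simp add: all_edges_def n_subsets)

lemma fin_graph_iff: "fin_graph G \<longleftrightarrow> finite (verts G) \<and> edges G \<subseteq> all_edges (verts G)"
  by (auto simp: fin_graph_def all_edges_def)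

lemma num_edges_le_choose:
  assumes "fin_graph G"
  shows "num_edges G \<le> card (verts G) choose 2"
  using assms card_mono[OF finite_all_edges]
  by (fastforce simp: fin_graph_iff num_edges_def simp flip: card_all_edges)

lemma edges_eq_all_edges:
  assumes "fin_graph G" "num_edges G = card (verts G) choose 2"
  shows "edges G = all_edges (verts G)"
  using assms by (intro card_subset_eq)
    (simp_all add: fin_graph_iff finite_all_edges card_all_edges num_edges_def)

lemma verts_nonempty_if_num_edges:
  assumes "fin_graph G" "num_edges G \<ge> 1"
  shows "verts G \<noteq> {}"
  using num_edges_le_choose[OF assms(1)] assms(2) by (auto simp: numeral_2_eq_2)

lemma subgraph_num_edges_le:
  assumes "subgraph H G"
  shows "num_edges H \<le> num_edges G"
  using assms finite_edges[of G] by (simp add: subgraph_def num_edges_def card_mono)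

lemma subgraph_eq_if_num_edges_eq:
  assumes "subgraph H G" "num_edges H = num_edges G" "no_isolated G"
  shows "H = G"
proof (rule prod_eqI)
  show edges_eq: "edges H = edges G"
    using assms(1,2) finite_edges[of G] by (simp add: subgraph_def num_edges_def card_subset_eq)
  have "verts G \<subseteq> \<Union> (edges G)"
    using assms(3) by (auto simp: no_isolated_def)
  also have "\<dots> \<subseteq> verts H"
    using assms(1) edges_eq by (auto simp: subgraph_def fin_graph_def)
  finally show "verts H = verts G"
    using assms(1) by (auto simp: subgraph_def)
qed

definition map_graph :: "('a \<Rightarrow> 'b) \<Rightarrow> 'a ugraph \<Rightarrow> 'b ugraph" where
  "map_graph f G = (f ` verts G, (\<lambda>e. f ` e) ` edges G)"

lemma graph_iso_iff_map_graph:
  "graph_iso G H \<longleftrightarrow> (\<exists>f. inj_on f (verts G) \<and> H = map_graph f G)"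
  by (auto simp: graph_iso_def map_graph_def bij_betw_def prod_eq_iff)

lemma
  assumes "fin_graph G" "inj_on f (verts G)"
  shows fin_graph_map_graph: "fin_graph (map_graph f G)"
    and num_edges_map_graph: "num_edges (map_graph f G) = num_edges G"
    and card_verts_map_graph: "card (verts (map_graph f G)) = card (verts G)"
  using graph_iso_subgraph[OF assms(2), of G] assms(1)
  by (simp_all add: map_graph_def subgraph_def)

lemma complete_graph_eq: "complete_graph p = ({..<p}, all_edges {..<p})"
  by (simp add: complete_graph_def all_edges_def)

lemma card_verts_complete_graph: "card (verts (complete_graph p)) = p"
  by (simp add: complete_graph_eq)

lemma num_edges_complete_graph: "num_edges (complete_graph p) = p choose 2"
  by (simp add: complete_graph_eq num_edges_def card_all_edges)

lemma graph_iso_complete_iff: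
  assumes G: "fin_graph G"
  shows "graph_iso G (complete_graph p) \<longleftrightarrow> card (verts G) = p \<and> num_edges G = p choose 2"
proof
  assume "graph_iso G (complete_graph p)"
  then show "card (verts G) = p \<and> num_edges G = p choose 2"
    using num_edges_map_graph[OF G] card_verts_map_graph[OF G]
    unfolding graph_iso_iff_map_graph
    by (metis card_verts_complete_graph num_edges_complete_graph)
next
  assume size: "card (verts G) = p \<and> num_edges G = p choose 2"
  then obtain f where f: "inj_on f (verts G)" "f ` verts G = {..<p}"
    using G bij_betw_iff_card[of "verts G" "{..<p}"] by (auto simp: fin_graph_def bij_betw_def)
  then have verts_eq: "verts (map_graph f G) = {..<p}"
    by (simp add: map_graph_def)
  then have "edges (map_graph f G) = all_edges {..<p}"
    using edges_eq_all_edges[OF fin_graph_map_graph[OF G f(1)]] num_edges_map_graph[OF G f(1)] size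
    by simp
  with verts_eq have "complete_graph p = map_graph f G"
    by (simp add: complete_graph_eq prod_eq_iff)
  with f(1) show "graph_iso G (complete_graph p)"
    by (auto simp: graph_iso_iff_map_graph)
qed

lemma contains_complete_iff:
  "contains_complete p G \<longleftrightarrow>
     (\<exists>H. subgraph H G \<and> card (verts H) = p \<and> num_edges H = p choose 2)"
  unfolding contains_complete_def by (metis graph_iso_complete_iff subgraph_def)

lemma contains_complete_iff_graph_iso:
  assumes "fin_graph G" "no_isolated G" "num_edges G = p choose 2"
  shows "contains_complete p G \<longleftrightarrow> graph_iso G (complete_graph p)"
proof
  assume "contains_complete p G"
  then obtain H where "subgraph H G" "graph_iso H (complete_graph p)" "num_edges H = p choose 2"
    by (metis contains_complete_def graph_iso_complete_iff subgraph_def)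
  then show "graph_iso G (complete_graph p)"
    using subgraph_eq_if_num_edges_eq assms by metis
next
  assume "graph_iso G (complete_graph p)"
  then show "contains_complete p G"
    using assms(1) unfolding contains_complete_def subgraph_def by blast
qed

abbreviation avg_degree :: "'a ugraph \<Rightarrow> real" where
  "avg_degree G \<equiv> 2 * real (num_edges G) / real (card (verts G))"

lemma avg_degree_le_card_minus_1:
  assumes "fin_graph G" "card (verts G) \<ge> 1"
  shows "avg_degree G \<le> real (card (verts G)) - 1"
proof -
  have "2 * real (num_edges G) \<le> 2 * real (card (verts G) choose 2)"
    using num_edges_le_choose[OF assms(1)] by simp
  also have "\<dots> = real (card (verts G)) * (real (card (verts G)) - 1)"
    by (rule of_nat_choose_two)
  finally show ?thesis
    using assms(2) by (simp add: divide_le_eq mult.commute)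
qed

lemma avg_degree_eq_card_minus_1_iff:
  assumes "card (verts G) \<ge> 1"
  shows "avg_degree G = real (card (verts G)) - 1 \<longleftrightarrow> num_edges G = card (verts G) choose 2"
proof -
  have "avg_degree G = real (card (verts G)) - 1 \<longleftrightarrow>
      2 * real (num_edges G) = 2 * real (card (verts G) choose 2)"
    unfolding of_nat_choose_two using assms by (simp add: divide_eq_eq mult.commute)
  then show ?thesis by simp
qed

definition mad_bound :: "nat \<Rightarrow> nat \<Rightarrow> real" where
  "mad_bound p m = max (real p - 1) (2 * real m / (real p + 1))"

lemma avg_degree_le_mad_bound:
  assumes "fin_graph G" "card (verts G) \<ge> 1" "num_edges G \<le> m"
  shows "avg_degree G \<le> mad_bound p m"
proof (cases "card (verts G) \<le> p")
  case True
  then have "avg_degree G \<le> real p - 1"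
    using avg_degree_le_card_minus_1[OF assms(1,2)] by linarith
  then show ?thesis by (simp add: mad_bound_def)
next
  case False
  then have "avg_degree G \<le> 2 * real m / (real p + 1)"
    using assms(3) by (intro frac_le) auto
  then show ?thesis by (simp add: mad_bound_def)
qed

lemma avg_degree_eq_mad_bound:
  assumes "fin_graph G" "card (verts G) \<ge> 1" "num_edges G \<le> m" "m \<ge> 1"
    and attained: "avg_degree G = mad_bound p m"
  obtains (complete) "card (verts G) = p" "num_edges G = p choose 2" "mad_bound p m = real p - 1"
    | (full) "card (verts G) = p + 1" "num_edges G = m"
        "mad_bound p m = 2 * real m / (real p + 1)"
proof (cases "card (verts G) \<le> p")
  case True
  have "avg_degree G \<ge> real p - 1" using attained by (simp add: mad_bound_def)
  then have "card (verts G) = p" "avg_degree G = real p - 1"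
    using True avg_degree_le_card_minus_1[OF assms(1,2)] by linarith+
  then show ?thesis
    using complete avg_degree_eq_card_minus_1_iff[OF assms(2)] attained by metis
next
  case False
  have full_le: "2 * real m / (real p + 1) \<le> avg_degree G"
    using attained by (simp add: mad_bound_def)
  also have "avg_degree G \<le> 2 * real m / real (card (verts G))"
    using assms(3) by (simp add: divide_right_mono)
  finally have "\<not> 2 * real m / real (card (verts G)) < 2 * real m / (real p + 1)"
    by simp
  then have "\<not> p + 1 < card (verts G)"
    using assms(4) divide_strict_left_mono[of "real p + 1" "real (card (verts G))" "2 * real m"]
    by auto
  then have "card (verts G) = p + 1" using False by simp
  moreover from this have "num_edges G = m"
    using full_le assms(3) by (simp add: divide_le_cancel add.commute)
  ultimately show ?thesis
    using full attained by (simp add: add.commute)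
qed

lemma mad_le_mad_bound:
  assumes "fin_graph G" "num_edges G \<ge> 1"
  shows "mad G \<le> mad_bound p (num_edges G)"
proof -
  obtain H where "subgraph H G" "card (verts H) \<ge> 1" "mad G = avg_degree H"
    using mad_attained[OF assms(1) verts_nonempty_if_num_edges[OF assms]] .
  then show ?thesis
    using avg_degree_le_mad_bound[of H] subgraph_num_edges_le[of H G] by (simp add: subgraph_def)
qed

lemma mad_ge_if_contains_complete:
  assumes "contains_complete p G" "p \<ge> 1"
  shows "mad G \<ge> real p - 1"
proof -
  obtain H where H: "subgraph H G" "card (verts H) = p" "num_edges H = p choose 2"
    using assms(1) by (auto simp: contains_complete_iff)
  then have "avg_degree H = real p - 1"
    using avg_degree_eq_card_minus_1_iff[of H] assms(2) by simp
  then show ?thesis using mad_ge[OF H(1)] H(2) assms(2) by simp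
qed

lemma avg_degree_le_mad:
  assumes "fin_graph G" "card (verts G) \<ge> 1"
  shows "avg_degree G \<le> mad G"
  using assms by (intro mad_ge) (simp_all add: subgraph_def)

lemma mad_eq_mad_bound_iff:
  assumes G: "fin_graph G" "no_isolated G" "num_edges G = m" and m: "m \<ge> 1" and p: "p \<ge> 1"
  shows "mad G = mad_bound p m \<longleftrightarrow>
     contains_complete p G \<and> mad_bound p m = real p - 1 \<or>
     card (verts G) = p + 1 \<and> mad_bound p m = 2 * real m / (real p + 1)" (is "?L \<longleftrightarrow> ?R")
proof
  assume ?L
  obtain H where H: "subgraph H G" "card (verts H) \<ge> 1" "mad G = avg_degree H"
    using mad_attained verts_nonempty_if_num_edges G m by metis
  have "fin_graph H" "card (verts H) \<ge> 1" "num_edges H \<le> m" "m \<ge> 1"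
      "avg_degree H = mad_bound p m"
    using H \<open>?L\<close> m G(3) subgraph_num_edges_le[of H G] by (simp_all add: subgraph_def)
  then show ?R
  proof (cases rule: avg_degree_eq_mad_bound)
    case complete
    then show ?thesis using H(1) contains_complete_iff by blast
  next
    case full
    then show ?thesis using subgraph_eq_if_num_edges_eq[OF H(1)] G by simp
  qed
next
  assume ?R
  then have "mad G \<ge> mad_bound p m"
    using mad_ge_if_contains_complete[of p G, OF _ p] avg_degree_le_mad[OF G(1)] G(3)
    by (auto simp: add.commute)
  then show ?L using mad_le_mad_bound[of G p] G m by simp
qed

definition complete_plus_vertex :: "nat \<Rightarrow> nat \<Rightarrow> nat ugraph" where
  "complete_plus_vertex p r = ({..p}, all_edges {..<p} \<union> (\<lambda>i. {i, p}) ` {..<r})"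

lemma fin_graph_complete_plus_vertex: "r \<le> p \<Longrightarrow> fin_graph (complete_plus_vertex p r)"
  by (auto simp: fin_graph_def complete_plus_vertex_def all_edges_def card_insert_if)

lemma card_verts_complete_plus_vertex: "card (verts (complete_plus_vertex p r)) = p + 1"
  by (simp add: complete_plus_vertex_def)

lemma num_edges_complete_plus_vertex:
  "num_edges (complete_plus_vertex p r) = (p choose 2) + r"
proof -
  have "inj_on (\<lambda>i. {i, p}) {..<r}"
    by (auto simp: inj_on_def doubleton_eq_iff)
  moreover have "all_edges {..<p} \<inter> (\<lambda>i. {i, p}) ` {..<r} = {}"
    by (auto simp: all_edges_def)
  ultimately show ?thesis
    by (simp add: complete_plus_vertex_def num_edges_def card_Un_disjoint card_image
        finite_all_edges card_all_edges)
qed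

lemma contains_complete_complete_plus_vertex:
  assumes "r \<le> p"
  shows "contains_complete p (complete_plus_vertex p r)"
proof -
  have "subgraph (complete_graph p) (complete_plus_vertex p r)"
    using fin_graph_complete_plus_vertex[OF assms]
    by (auto simp: subgraph_def fin_graph_iff complete_graph_eq complete_plus_vertex_def)
  then show ?thesis
    using card_verts_complete_graph num_edges_complete_graph
    unfolding contains_complete_iff by blast
qed

lemma mad_complete_plus_vertex_ge:
  assumes "r \<le> p" "p \<ge> 1"
  shows "mad (complete_plus_vertex p r) \<ge> mad_bound p ((p choose 2) + r)"
  using mad_ge_if_contains_complete[OF contains_complete_complete_plus_vertex[OF assms(1)] assms(2)]
    avg_degree_le_mad[OF fin_graph_complete_plus_vertex[OF assms(1)]]
  by (simp add: mad_bound_def card_verts_complete_plus_vertex num_edges_complete_plus_vertex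
      add.commute)

lemma max_mad_eq_mad_bound:
  assumes m: "m = (p choose 2) + r" "m \<ge> 1" and r: "r \<le> p"
  shows "max_mad m = mad_bound p m"
proof (rule antisym)
  show "max_mad m \<le> mad_bound p m"
    unfolding max_mad_def using mad_le_mad_bound m(2)
    by (intro Max.boundedI[OF finite_max_mad_set[OF m(2)] max_mad_set_nonempty]) blast
  have "p \<ge> 1" using m r by (cases p) (auto simp: binomial_eq_0)
  then have "mad_bound p m \<le> mad (complete_plus_vertex p r)"
    using mad_complete_plus_vertex_ge r m(1) by simp
  also have "\<dots> \<le> max_mad m"
    using fin_graph_complete_plus_vertex[OF r] num_edges_complete_plus_vertex m
    by (intro mad_le_max_mad) simp_all
  finally show "mad_bound p m \<le> max_mad m" .
qed

lemma full_density_eq: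
  assumes "m = (p choose 2) + r"
  shows "2 * real m / (real p + 1) = real p - 1 + (2 * real r - (real p - 1)) / (real p + 1)"
proof -
  have "2 * real m = real p * (real p - 1) + 2 * real r"
    using of_nat_choose_two[of p, where 'a = real] assms by simp
  then show ?thesis by (simp add: field_simps)
qed

lemma mad_bound_eq_complete_iff:
  assumes "m = (p choose 2) + r"
  shows "mad_bound p m = real p - 1 \<longleftrightarrow> real r \<le> (real p - 1) / 2"
  unfolding mad_bound_def full_density_eq[OF assms]
  by (auto simp: max_def divide_le_0_iff zero_le_divide_iff)

lemma mad_bound_eq_full_iff:
  assumes "m = (p choose 2) + r"
  shows "mad_bound p m = 2 * real m / (real p + 1) \<longleftrightarrow> real r \<ge> (real p - 1) / 2"
  unfolding mad_bound_def full_density_eq[OF assms]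
  by (auto simp: max_def divide_le_0_iff zero_le_divide_iff)

lemma mad_eq_max_mad_iff:
  assumes G: "fin_graph G" "no_isolated G" "num_edges G = m"
    and m: "m = (p choose 2) + r" "m \<ge> 1" and r: "r \<le> p"
  shows "mad G = max_mad m \<longleftrightarrow>
     contains_complete p G \<and> real r \<le> (real p - 1) / 2 \<or>
     card (verts G) = p + 1 \<and> real r \<ge> (real p - 1) / 2"
proof -
  have "p \<ge> 1" using m r by (cases p) (auto simp: binomial_eq_0)
  from mad_eq_mad_bound_iff[OF G m(2) this] show ?thesis
    by (simp only: max_mad_eq_mad_bound[OF m r] mad_bound_eq_complete_iff[OF m(1)]
        mad_bound_eq_full_iff[OF m(1)])
qed

theorem theorem3p1:
  fixes p m :: nat
  assumes "p \<ge> 2"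
  shows
    "(m = p choose 2 \<longrightarrow>
        max_mad m = real p - 1 \<and>
        (\<forall>G :: 'a ugraph. fin_graph G \<and> no_isolated G \<and> num_edges G = m \<longrightarrow>
           (mad G = max_mad m \<longleftrightarrow> graph_iso G (complete_graph p)))) \<and>
     (p choose 2 < m \<and> m < (p + 1) choose 2 \<longrightarrow>
        (\<exists>r. 0 < r \<and> r < p \<and> m = (p choose 2) + r \<and>
           max_mad m = max (real p - 1) (2 * real m / (real p + 1)) \<and>
           (\<forall>G :: 'a ugraph. fin_graph G \<and> no_isolated G \<and> num_edges G = m \<longrightarrow>
              (real r < (real p - 1) / 2 \<longrightarrow>
                 (mad G = max_mad m \<longleftrightarrow> contains_complete p G)) \<and>
              (real r > (real p - 1) / 2 \<longrightarrow>
                 (mad G = max_mad m \<longleftrightarrow> card (verts G) = p + 1)) \<and>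
              (real r = (real p - 1) / 2 \<longrightarrow>
                 (mad G = max_mad m \<longleftrightarrow>
                    contains_complete p G \<or> card (verts G) = p + 1)))))"
proof (intro conjI impI allI, goal_cases clique_value clique_unique intermediate)
  case clique_value
  have "m \<ge> 1" using clique_value assms by (simp add: Suc_le_eq zero_less_binomial)
  then show ?case
    using max_mad_eq_mad_bound[of m p 0] mad_bound_eq_complete_iff[of m p 0]
      clique_value assms
    by simp
next
  case (clique_unique G)
  then have "m \<ge> 1" using assms by (simp add: Suc_le_eq zero_less_binomial)
  then have "mad G = max_mad m \<longleftrightarrow> contains_complete p G"
    using mad_eq_max_mad_iff[of G m p 0] clique_unique assms by simp
  also have "\<dots> \<longleftrightarrow> graph_iso G (complete_graph p)"
    using contains_complete_iff_graph_iso clique_unique by blast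
  finally show ?case .
next
  case intermediate
  define r where "r = m - (p choose 2)"
  have r: "0 < r" "r < p" and m: "m = (p choose 2) + r" "m \<ge> 1"
    using intermediate Suc_choose_two[of p] by (auto simp: r_def)
  have max_mad_value: "max_mad m = max (real p - 1) (2 * real m / (real p + 1))"
    using max_mad_eq_mad_bound[OF m] r(2) by (simp add: mad_bound_def)
  note extremal_iff = mad_eq_max_mad_iff[OF _ _ _ m less_imp_le[OF r(2)]]
  show ?case
    by (intro exI[of _ r] conjI allI impI r m(1) max_mad_value) (auto simp: extremal_iff)
qed

end
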